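(* For any $u \in A^*$, the Baxter $\mathsf{P}$-symbol of $u$ and the iterative Baxter $\mathsf{P}$-symbol of $u$ are equal.
   Context: $A = \{a_1 < a_2 < \cdots\}$ is a totally ordered infinite alphabet and $A^*$ is the free monoid of words on $A$. A binary tree is either empty (a leaf) or a node with a left and a right binary subtree. A tree with nodes labeled by $A$ is a right (resp. left) binary search tree if for every node labeled by $b$, every label $a$ in its left subtree and every label $c$ in its right subtree, one has $a \leq b < c$ (resp. $a < b \leq c$). Leaf insertion of a letter $a$ into a right (resp. left) binary search tree $T$: if $T$ is empty, return the one-node tree labeled $a$; otherwise, with $b$ the label of the root, if $a \leq b$ (resp. $a<b$) recursively leaf insert $a$ into the left subtree, otherwise into the right subtree. Baxter $\mathsf{P}$-symbol of $u$: the pair $(T_L,T_R)$ where $T_L$ (resp. $T_R$) is the left (resp. right) binary search tree obtained by leaf inserting the letters of $u$ from left to right (resp. right to left), starting from the empty tree. Root insertion: for a right binary search tree $T$ and a letter $b$, $T_{\leq b}$ is the right binary search tree made exactly of the nodes of $T$ labeled by letters $a \leq b$, and such that for all nodes $x, y$ of $T_{\leq b}$, if $x$ is an ancestor of $y$ in $T_{\leq b}$ then $x$ is an ancestor of $y$ in $T$; $T_{> b}$ is defined in the same way with the nodes labeled by letters $> b$. The root insertion of a letter $a$ into $T$ produces the tree whose root is a new node labeled by $a$, with left subtree $T_{\leq a}$ and right subtree $T_{> a}$. Iterative Baxter $\mathsf{P}$-symbol of $u$: the pair obtained from the pair of empty trees by inserting successively the letters of $u$ from left to right, where the insertion of a letter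 $a$ into $(T_L,T_R)$ consists in making a leaf insertion of $a$ into the left binary search tree $T_L$ and a root insertion of $a$ into the right binary search tree $T_R$. *)

theory Defs
  imports "HOL-Library.Tree" "HOL-Library.Sublist"
begin

fun right_bst :: "'a::linorder tree \<Rightarrow> bool" where
  "right_bst Leaf \<longleftrightarrow> True"
| "right_bst (Node l b r) \<longleftrightarrow>
     (\<forall>a\<in>set_tree l. a \<le> b) \<and> (\<forall>c\<in>set_tree r. b < c) \<and> right_bst l \<and> right_bst r"

fun left_leaf_insert :: "'a::linorder \<Rightarrow> 'a tree \<Rightarrow> 'a tree" where
  "left_leaf_insert a Leaf = Node Leaf a Leaf"
| "left_leaf_insert a (Node l b r) =
     (if a < b then Node (left_leaf_insert a l) b r else Node l b (left_leaf_insert a r))"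

fun right_leaf_insert :: "'a::linorder \<Rightarrow> 'a tree \<Rightarrow> 'a tree" where
  "right_leaf_insert a Leaf = Node Leaf a Leaf"
| "right_leaf_insert a (Node l b r) =
     (if a \<le> b then Node (right_leaf_insert a l) b r else Node l b (right_leaf_insert a r))"

definition baxter_P :: "'a::linorder list \<Rightarrow> 'a tree \<times> 'a tree" where
  "baxter_P u = (fold left_leaf_insert u Leaf, fold right_leaf_insert (rev u) Leaf)"

text \<open>A label may occur several times in a tree, so nodes are identified with their
  access paths from the root (False: go left, True: go right). A node is an ancestor of
  another one iff its path is a strict prefix of the path of the other one.\<close>

fun nodes :: "'a tree \<Rightarrow> bool list set" where
  "nodes Leaf = {}"
| "nodes (Node l a r) = insert [] ((#) False ` nodes l \<union> (#) True ` nodes r)"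

text \<open>Only meaningful for paths in \<open>nodes T\<close>.\<close>

fun label :: "'a tree \<Rightarrow> bool list \<Rightarrow> 'a" where
  "label (Node l a r) [] = a"
| "label (Node l a r) (d # p) = label (if d then r else l) p"
| "label Leaf p = undefined"

definition ancestor :: "bool list \<Rightarrow> bool list \<Rightarrow> bool" where
  "ancestor x y \<longleftrightarrow> strict_prefix x y"

text \<open>\<open>S\<close> is a right binary search tree made exactly of the nodes of \<open>T\<close> whose label
  satisfies \<open>P\<close>, such that ancestors in \<open>S\<close> are ancestors in \<open>T\<close>. The map \<open>f\<close> sends a node
  of \<open>S\<close> to the node of \<open>T\<close> that it is.\<close>

definition is_restriction :: "('a::linorder \<Rightarrow> bool) \<Rightarrow> 'a tree \<Rightarrow> 'a tree \<Rightarrow> bool" where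
  "is_restriction P T S \<longleftrightarrow> right_bst S \<and>
     (\<exists>f. bij_betw f (nodes S) {x \<in> nodes T. P (label T x)} \<and>
          (\<forall>x\<in>nodes S. label S x = label T (f x)) \<and>
          (\<forall>x\<in>nodes S. \<forall>y\<in>nodes S. ancestor x y \<longrightarrow> ancestor (f x) (f y)))"

text \<open>If \<open>T\<close> is a right binary search tree, such a tree \<open>S\<close> exists and is unique for the two
  choices of \<open>P\<close> below.\<close>

definition restrict_le :: "'a::linorder tree \<Rightarrow> 'a \<Rightarrow> 'a tree" where
  "restrict_le T b = (THE S. is_restriction (\<lambda>a. a \<le> b) T S)"

definition restrict_gt :: "'a::linorder tree \<Rightarrow> 'a \<Rightarrow> 'a tree" where
  "restrict_gt T b = (THE S. is_restriction (\<lambda>a. a > b) T S)"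

definition root_insert :: "'a::linorder \<Rightarrow> 'a tree \<Rightarrow> 'a tree" where
  "root_insert a T = Node (restrict_le T a) a (restrict_gt T a)"

definition iterative_baxter_P :: "'a::linorder list \<Rightarrow> 'a tree \<times> 'a tree" where
  "iterative_baxter_P u =
     fold (\<lambda>a (TL, TR). (left_leaf_insert a TL, root_insert a TR)) u (Leaf, Leaf)"

end

theory Submission
  imports Defs
begin

text \<open>Inserting the letters of \<open>u\<close> from right to left puts the last letter \<open>a\<close> at the root, and
  every other letter then goes to the left or the right subtree according to whether it is
  \<open>\<le> a\<close> or \<open>> a\<close>. Leaf insertion commutes with restricting a right binary search tree to an
  interval of letters, so these two subtrees are the restrictions of the tree of \<open>butlast u\<close>, i.e.
  the last letter acts by root insertion. As restrictions are specified through the ancestor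
  relation, the work lies in showing that they exist (by the recursive function \<open>prune\<close>) and
  are unique (the root must be the node above all the others, and its label decides on which side
  each other node lies).\<close>

section \<open>Uniqueness of restrictions\<close>

lemma label_in_set_tree: "p \<in> nodes t \<Longrightarrow> label t p \<in> set_tree t"
  by (induction t arbitrary: p) auto

text \<open>An arbitrary labelling \<open>g\<close> and an arbitrary set \<open>X\<close> of paths
  replace the tree \<open>T\<close>, because the nodes hit by a subtree of \<open>S\<close> need not
  form a subtree of \<open>T\<close>. This makes induction on \<open>S\<close> possible.\<close>

definition node_map :: "(bool list \<Rightarrow> 'a::linorder) \<Rightarrow> bool list set \<Rightarrow> 'a tree
    \<Rightarrow> (bool list \<Rightarrow> bool list) \<Rightarrow> bool" where
  "node_map g X S f \<longleftrightarrow> right_bst S \<and> bij_betw f (nodes S) X \<and>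
     (\<forall>x\<in>nodes S. label S x = g (f x)) \<and>
     (\<forall>x\<in>nodes S. \<forall>y\<in>nodes S. ancestor x y \<longrightarrow> ancestor (f x) (f y))"

lemma is_restriction_iff_node_map:
  "is_restriction P T S \<longleftrightarrow> (\<exists>f. node_map (label T) {x \<in> nodes T. P (label T x)} S f)"
  by (auto simp: is_restriction_def node_map_def)

text \<open>The search tree order puts the labels on the left of \<open>b\<close> and those on the
  right above it, so the target set of the left subtree depends only on \<open>X\<close>,
  \<open>f []\<close> and \<open>b\<close>. The root is removed explicitly since its own label
  \<open>b\<close> satisfies \<open>g x \<le> b\<close>.\<close>

lemma node_map_left:
  assumes "node_map g X (Node l b r) f"
  shows "node_map g {x \<in> X - {f []}. g x \<le> b} l (f \<circ> (#) False)"
proof -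
  have inj: "inj_on f (nodes (Node l b r))" and img: "f ` nodes (Node l b r) = X"
    and lab: "\<And>x. x \<in> nodes (Node l b r) \<Longrightarrow> label (Node l b r) x = g (f x)"
    and anc: "\<And>x y. \<lbrakk>x \<in> nodes (Node l b r); y \<in> nodes (Node l b r); ancestor x y\<rbrakk>
      \<Longrightarrow> ancestor (f x) (f y)"
    and bst: "right_bst (Node l b r)"
    using assms unfolding node_map_def bij_betw_def by blast+
  have le: "g (f (False # p)) \<le> b" if "p \<in> nodes l" for p
    using lab[of "False # p"] that bst label_in_set_tree[OF that] by auto
  have gt: "\<not> g (f (True # p)) \<le> b" if "p \<in> nodes r" for p
    using lab[of "True # p"] that bst label_in_set_tree[OF that] by auto
  have ne: "f (False # p) \<noteq> f []" if "p \<in> nodes l" for p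
    using inj_onD[OF inj, of "False # p" "[]"] that by auto
  have "(f \<circ> (#) False) ` nodes l = {x \<in> X - {f []}. g x \<le> b}"
    unfolding img[symmetric] using le gt ne by auto
  moreover have "inj_on (f \<circ> (#) False) (nodes l)"
    by (rule comp_inj_on) (auto intro: inj_on_subset[OF inj])
  moreover have "ancestor (f (False # x)) (f (False # y))"
    if "x \<in> nodes l" "y \<in> nodes l" "ancestor x y" for x y
    using that by (intro anc) (auto simp: ancestor_def)
  moreover have "label l p = g (f (False # p))" if "p \<in> nodes l" for p
    using lab[of "False # p"] that by simp
  ultimately show ?thesis
    using bst by (simp add: node_map_def bij_betw_def)
qed

lemma node_map_right:
  assumes "node_map g X (Node l b r) f"
  shows "node_map g {x \<in> X - {f []}. b < g x} r (f \<circ> (#) True)"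
proof -
  have inj: "inj_on f (nodes (Node l b r))" and img: "f ` nodes (Node l b r) = X"
    and lab: "\<And>x. x \<in> nodes (Node l b r) \<Longrightarrow> label (Node l b r) x = g (f x)"
    and anc: "\<And>x y. \<lbrakk>x \<in> nodes (Node l b r); y \<in> nodes (Node l b r); ancestor x y\<rbrakk>
      \<Longrightarrow> ancestor (f x) (f y)"
    and bst: "right_bst (Node l b r)"
    using assms unfolding node_map_def bij_betw_def by blast+
  have le: "\<not> b < g (f (False # p))" if "p \<in> nodes l" for p
    using lab[of "False # p"] that bst label_in_set_tree[OF that] by auto
  have gt: "b < g (f (True # p))" if "p \<in> nodes r" for p
    using lab[of "True # p"] that bst label_in_set_tree[OF that] by auto
  have ne: "f (True # p) \<noteq> f []" if "p \<in> nodes r" for p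
    using inj_onD[OF inj, of "True # p" "[]"] that by auto
  have "(f \<circ> (#) True) ` nodes r = {x \<in> X - {f []}. b < g x}"
    unfolding img[symmetric] using le gt ne by auto
  moreover have "inj_on (f \<circ> (#) True) (nodes r)"
    by (rule comp_inj_on) (auto intro: inj_on_subset[OF inj])
  moreover have "ancestor (f (True # x)) (f (True # y))"
    if "x \<in> nodes r" "y \<in> nodes r" "ancestor x y" for x y
    using that by (intro anc) (auto simp: ancestor_def)
  moreover have "label r p = g (f (True # p))" if "p \<in> nodes r" for p
    using lab[of "True # p"] that by simp
  ultimately show ?thesis
    using bst by (simp add: node_map_def bij_betw_def)
qed

text \<open>The empty path is a strict prefix of every other path, and \<open>f\<close> preserves
  ancestors.\<close>

lemma node_map_root_ancestor:
  assumes "node_map g X (Node l b r) f" "x \<in> X" "x \<noteq> f []"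
  shows "ancestor (f []) x"
proof -
  obtain p where p: "p \<in> nodes (Node l b r)" "x = f p"
    using assms(1,2) by (auto simp: node_map_def bij_betw_def)
  moreover from this have "ancestor [] p"
    using assms(3) by (cases p) (auto simp: ancestor_def)
  ultimately show ?thesis
    using assms(1) by (auto simp: node_map_def)
qed

lemma node_map_unique:
  assumes "node_map g X S f" "node_map g X S' f'"
  shows "S = S'"
  using assms
proof (induction S arbitrary: S' X f f')
  case Leaf
  then show ?case
    by (cases S') (auto simp: node_map_def bij_betw_def)
next
  case (Node l b r)
  then obtain l' b' r' where S': "S' = Node l' b' r'"
    by (cases S') (auto simp: node_map_def bij_betw_def)
  note m = Node.prems(1) and m' = Node.prems(2)[unfolded S']
  \<comment> \<open>If the roots had different images, each image would be an ancestor of the other,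
    but strict prefix is asymmetric.\<close>
  have root: "f [] = f' []"
  proof (rule ccontr)
    assume ne: "f [] \<noteq> f' []"
    have "f [] \<in> X" "f' [] \<in> X"
      using m m' by (auto simp: node_map_def bij_betw_def)
    then have "ancestor (f []) (f' [])" "ancestor (f' []) (f [])"
      using node_map_root_ancestor m m' ne by metis+
    then show False
      by (auto simp: ancestor_def)
  qed
  then have b: "b = b'"
    using m m' by (simp add: node_map_def)
  have "l = l'"
    using Node.IH(1) node_map_left[OF m] node_map_left[OF m'] unfolding root b by blast
  moreover have "r = r'"
    using Node.IH(2) node_map_right[OF m] node_map_right[OF m'] unfolding root b by blast
  ultimately show ?case
    by (simp add: S' b)
qed

section \<open>Existence of restrictions to intervals\<close>

text \<open>Order convexity treats both restrictions, \<open>\<le> a\<close> and \<open>> a\<close>,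
  at once.\<close>

definition interval_pred :: "('a::linorder \<Rightarrow> bool) \<Rightarrow> bool" where
  "interval_pred P \<longleftrightarrow> (\<forall>x y z. x \<le> y \<longrightarrow> y \<le> z \<longrightarrow> P x \<longrightarrow> P z \<longrightarrow> P y)"

lemma interval_predD: "\<lbrakk>interval_pred P; x \<le> y; y \<le> z; P x; P z\<rbrakk> \<Longrightarrow> P y"
  by (auto simp: interval_pred_def)

lemma interval_pred_le [simp]: "interval_pred (\<lambda>x. x \<le> a)"
  by (auto simp: interval_pred_def)

lemma interval_pred_gt [simp]: "interval_pred (\<lambda>x. x > a)"
  by (auto simp: interval_pred_def)

text \<open>For a right binary search tree and an interval, one of the two subtrees of a discarded node
  disappears entirely, so the last case loses nothing.\<close>

fun prune :: "('a \<Rightarrow> bool) \<Rightarrow> 'a tree \<Rightarrow> 'a tree" where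
  "prune P Leaf = Leaf"
| "prune P (Node l b r) =
     (if P b then Node (prune P l) b (prune P r)
      else if prune P l = Leaf then prune P r else prune P l)"

lemma prune_eq_Leaf: "(\<And>x. x \<in> set_tree t \<Longrightarrow> \<not> P x) \<Longrightarrow> prune P t = Leaf"
  by (induction t) auto

text \<open>If \<open>x\<close> in \<open>l\<close> and \<open>z\<close> in \<open>r\<close> both
  satisfied \<open>P\<close>, then \<open>x \<le> b < z\<close> and convexity would force
  \<open>P b\<close>.\<close>

lemma prune_Leaf_cases:
  assumes "interval_pred P" "right_bst (Node l b r)" "\<not> P b"
  obtains "\<And>x. x \<in> set_tree l \<Longrightarrow> \<not> P x" "prune P l = Leaf"
    | "\<And>x. x \<in> set_tree r \<Longrightarrow> \<not> P x" "prune P r = Leaf"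
proof (cases "\<exists>x\<in>set_tree l. P x")
  case True
  then obtain x where x: "x \<in> set_tree l" "P x" by blast
  have "\<not> P z" if "z \<in> set_tree r" for z
    using interval_predD[OF assms(1), of x b z] assms x that by (auto simp: less_imp_le)
  then show ?thesis
    using that(2) prune_eq_Leaf by metis
next
  case False
  then show ?thesis
    using that(1) prune_eq_Leaf by metis
qed

lemma set_tree_prune: "set_tree (prune P t) \<subseteq> set_tree t"
  by (induction t) auto

lemma right_bst_prune: "right_bst t \<Longrightarrow> right_bst (prune P t)"
proof (induction t)
  case (Node l b r)
  then show ?case
    using set_tree_prune[of P l] set_tree_prune[of P r] by (auto simp: subset_iff)
qed simp

lemma node_map_into_left:
  "node_map (label l) X S f \<Longrightarrow>
    node_map (label (Node l b r)) ((#) False ` X) S ((#) False \<circ> f)"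
  by (simp add: node_map_def ancestor_def bij_betw_def inj_on_def flip: image_image)

lemma node_map_into_right:
  "node_map (label r) X S f \<Longrightarrow>
    node_map (label (Node l b r)) ((#) True ` X) S ((#) True \<circ> f)"
  by (simp add: node_map_def ancestor_def bij_betw_def inj_on_def flip: image_image)

lemma node_map_Node:
  assumes "node_map (label l) X L f" "node_map (label r) Y R g" "right_bst (Node L b R)"
  shows "\<exists>h. node_map (label (Node l b r))
    (insert [] ((#) False ` X \<union> (#) True ` Y)) (Node L b R) h"
proof -
  \<comment> \<open>The two maps are glued: the root goes to the root, and the first direction of
    any other path is kept and selects the map for the rest.\<close>
  define h where "h p = (case p of [] \<Rightarrow> [] | d # q \<Rightarrow> d # (if d then g else f) q)" for p
  have [simp]: "h [] = []" "h (True # p) = True # g p" "h (False # p) = False # f p" for p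
    by (simp_all add: h_def)
  have inj: "inj_on f (nodes L)" "inj_on g (nodes R)"
    and X: "X = f ` nodes L" and Y: "Y = g ` nodes R"
    using assms by (auto simp: node_map_def bij_betw_def)
  have "node_map (label (Node l b r)) (insert [] ((#) False ` X \<union> (#) True ` Y)) (Node L b R) h"
    unfolding node_map_def bij_betw_def
  proof (intro conjI ballI impI)
    show "inj_on h (nodes (Node L b R))"
      using inj by (auto simp: inj_on_def)
    show "h ` nodes (Node L b R) = insert [] ((#) False ` X \<union> (#) True ` Y)"
      by (simp add: X Y image_Un image_image)
    show "label (Node L b R) x = label (Node l b r) (h x)" if "x \<in> nodes (Node L b R)" for x
      using assms that by (auto simp: node_map_def)
    show "ancestor (h x) (h y)"
      if "x \<in> nodes (Node L b R)" "y \<in> nodes (Node L b R)" "ancestor x y" for x y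
      using assms that by (auto simp: node_map_def ancestor_def)
  qed (fact assms(3))
  then show ?thesis by blast
qed

lemma is_restriction_prune:
  assumes "interval_pred P" "right_bst t"
  shows "is_restriction P t (prune P t)"
  using assms(2)
proof (induction t)
  case Leaf
  then show ?case by (simp add: is_restriction_def bij_betw_def)
next
  case (Node l b r)
  let ?L = "{x \<in> nodes l. P (label l x)}" and ?R = "{x \<in> nodes r. P (label r x)}"
  let ?T = "Node l b r"
  obtain f g where f: "node_map (label l) ?L (prune P l) f"
    and g: "node_map (label r) ?R (prune P r) g"
    using Node by (auto simp: is_restriction_iff_node_map)
  have nodes_T: "{x \<in> nodes ?T. P (label ?T x)} =
      (if P b then {[]} else {}) \<union> ((#) False ` ?L \<union> (#) True ` ?R)"
    by auto
  show ?case
  proof (cases "P b")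
    case True
    then show ?thesis
      using node_map_Node[OF f g, of b] right_bst_prune[OF Node.prems, of P]
      unfolding is_restriction_iff_node_map nodes_T by simp
  next
    case False
    from assms(1) Node.prems this show ?thesis
    proof (cases rule: prune_Leaf_cases)
      case 1
      then have "?L = {}"
        using label_in_set_tree by blast
      then have "{x \<in> nodes ?T. P (label ?T x)} = (#) True ` ?R"
        unfolding nodes_T using False by (simp only: if_False image_empty Un_empty_left)
      moreover have "prune P ?T = prune P r"
        using False 1(2) by simp
      ultimately show ?thesis
        unfolding is_restriction_iff_node_map using node_map_into_right[OF g] by metis
    next
      case 2
      then have "?R = {}"
        using label_in_set_tree by blast
      then have "{x \<in> nodes ?T. P (label ?T x)} = (#) False ` ?L"
        unfolding nodes_T using False
        by (simp only: if_False image_empty Un_empty_left Un_empty_right)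
      moreover have "prune P ?T = prune P l"
        using False 2(2) by simp
      ultimately show ?thesis
        unfolding is_restriction_iff_node_map using node_map_into_left[OF f] by metis
    qed
  qed
qed

lemma the_restriction:
  assumes "interval_pred P" "right_bst t"
  shows "(THE S. is_restriction P t S) = prune P t"
proof (rule the_equality)
  show "is_restriction P t (prune P t)"
    using assms by (rule is_restriction_prune)
  then show "S = prune P t" if "is_restriction P t S" for S
    using that node_map_unique unfolding is_restriction_iff_node_map by blast
qed

lemma root_insert_prune:
  assumes "right_bst t"
  shows "root_insert a t = Node (prune (\<lambda>x. x \<le> a) t) a (prune (\<lambda>x. x > a) t)"
  using assms
  by (simp add: root_insert_def restrict_le_def restrict_gt_def the_restriction)

section \<open>Leaf insertion and restrictions\<close>

lemma set_tree_right_leaf_insert [simp]: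
  "set_tree (right_leaf_insert a t) = insert a (set_tree t)"
  by (induction t) auto

lemma right_bst_right_leaf_insert: "right_bst t \<Longrightarrow> right_bst (right_leaf_insert a t)"
  by (induction t) auto

lemma right_bst_fold_right_leaf_insert:
  "right_bst t \<Longrightarrow> right_bst (fold right_leaf_insert v t)"
  by (induction v arbitrary: t) (auto simp: right_bst_right_leaf_insert)

lemma right_leaf_insert_neq_Leaf [simp]: "right_leaf_insert a t \<noteq> Leaf"
  by (cases t) auto

text \<open>At a kept root, insertion takes the same branch before and after pruning. At a discarded
  root, if \<open>P a\<close> holds, then \<open>a\<close> enters the side that survives
  pruning.\<close>

lemma prune_right_leaf_insert:
  assumes "interval_pred P" "right_bst t"
  shows "prune P (right_leaf_insert a t) =
    (if P a then right_leaf_insert a (prune P t) else prune P t)"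
  using assms(2)
proof (induction t)
  case Leaf
  then show ?case by simp
next
  case (Node l b r)
  show ?case
  proof (cases "P b")
    case True
    then show ?thesis using Node by auto
  next
    case False
    have "right_bst (right_leaf_insert a (Node l b r))"
      using Node.prems by (rule right_bst_right_leaf_insert)
    then show ?thesis
    proof (cases "a \<le> b")
      case True
      \<comment> \<open>The case split is applied to the tree after insertion: if its left side has
        no label satisfying \<open>P\<close>, then \<open>P a\<close> fails as well.\<close>
      then have "right_bst (Node (right_leaf_insert a l) b r)"
        using \<open>right_bst (right_leaf_insert a (Node l b r))\<close> by simp
      from assms(1) this False show ?thesis
        by (cases rule: prune_Leaf_cases) (use Node True False in auto)
    next
      case gt: False
      then have "right_bst (Node l b (right_leaf_insert a r))"
        using \<open>right_bst (right_leaf_insert a (Node l b r))\<close> by simp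
      from assms(1) this False show ?thesis
        by (cases rule: prune_Leaf_cases) (use Node gt False in auto)
    qed
  qed
qed

lemma prune_fold_right_leaf_insert:
  assumes "interval_pred P" "right_bst t"
  shows "prune P (fold right_leaf_insert v t) = fold right_leaf_insert (filter P v) (prune P t)"
  using assms(2)
  by (induction v arbitrary: t)
    (simp_all add: prune_right_leaf_insert assms(1) right_bst_right_leaf_insert)

text \<open>Leaf insertion never moves the root, and letters sent to different sides do not
  interact.\<close>

lemma fold_right_leaf_insert_Node:
  "fold right_leaf_insert v (Node l b r) =
    Node (fold right_leaf_insert (filter (\<lambda>x. x \<le> b) v) l) b
      (fold right_leaf_insert (filter (\<lambda>x. x > b) v) r)"
  by (induction v arbitrary: l r) auto

text \<open>Both sides have root \<open>a\<close> and subtrees built from the letters of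
  \<open>v\<close> that are \<open>\<le> a\<close> and \<open>> a\<close>, inserted in the order of
  \<open>v\<close>.\<close>

lemma root_insert_fold_right_leaf_insert:
  "root_insert a (fold right_leaf_insert v Leaf) = fold right_leaf_insert v (Node Leaf a Leaf)"
  by (simp add: root_insert_prune right_bst_fold_right_leaf_insert prune_fold_right_leaf_insert
      fold_right_leaf_insert_Node)

theorem proposition4p19:
  fixes a :: "nat \<Rightarrow> 'a::linorder" and A :: "'a set" and u :: "'a list"
  assumes "strict_mono_on {1..} a" and "A = a ` {1..}"
    and "u \<in> lists A"
  shows "baxter_P u = iterative_baxter_P u"
proof (induction u rule: rev_induct)
  case Nil
  then show ?case
    by (simp add: baxter_P_def iterative_baxter_P_def)
next
  case (snoc x u)
  have "iterative_baxter_P (u @ [x]) =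
      (\<lambda>(TL, TR). (left_leaf_insert x TL, root_insert x TR)) (iterative_baxter_P u)"
    by (simp add: iterative_baxter_P_def)
  \<comment> \<open>Since \<open>rev (u @ [x]) = x # rev u\<close>, the letter \<open>x\<close> is
    leaf inserted first in the right tree, which matches a final root insertion. The left trees grow
    by the same leaf insertion.\<close>
  then show ?case
    by (simp add: baxter_P_def root_insert_fold_right_leaf_insert flip: snoc.IH)
qed

end
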